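(* Let $X$ be a smooth vector field on $\mathbb{H}^2$, let $\lambda,\rho\in\mathbb{R}$, and let $G:\mathbb{H}^2\to\mathbb{R}$ be a smooth nowhere vanishing function. Then $(\mathbb{H}^2,ds^2,X,\lambda,\rho)$ is a $G$-Ricci-Bourguignon soliton if and only if there exist $f\in C^\infty(\mathbb{R})$ and $h\in C^\infty((0,\infty))$ such that \begin{align*} X_{(x,y)}&=\left(\int f(x)\,dx+(\lambda-2\rho+1)\left(\int\left(\int\frac{dy}{yG(x,y)}\right)dx+\int\frac{dx}{G(x,y)}\right)+h(y)\right)\frac{\partial}{\partial x}\\ &\quad+\left(f(x)\,y+(\lambda-2\rho+1)\,y\int\frac{dy}{yG(x,y)}\right)\frac{\partial}{\partial y} \end{align*} and \[ h'(y)+f'(x)\,y=(-\lambda+2\rho-1)\left(\frac{\partial}{\partial x}\left(y\int\frac{dy}{yG(x,y)}\right)+\frac{\partial}{\partial y}\left(\int\left(\int\frac{dy}{yG(x,y)}\right)dx\right)+\frac{\partial}{\partial y}\left(\int\frac{dx}{G(x,y)}\right)\right) \] for all $(x,y)\in\mathbb{H}^2$. Moreover, in this case the components of $X$ are harmonic: writing $X=M\,\partial_x+N\,\partial_y$, one has $M_{xx}+M_{yy}=0$ and $N_{xx}+N_{yy}=0$ on $\mathbb{H}^2$.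
   Context: $\mathbb{H}^2=\{(x,y)\in\mathbb{R}^2 : y>0\}$ with the hyperbolic metric $ds^2=\frac{dx^2+dy^2}{y^2}$. For a Riemannian manifold $(M,g)$ with Ricci tensor $\mathrm{Ric}$ and scalar curvature $S$, a smooth vector field $X$, real constants $\lambda,\rho$ and a smooth nowhere vanishing function $G$, the manifold is called a $G$-Ricci-Bourguignon soliton if $\mathrm{Ric}+\frac{G}{2}\mathcal{L}_Xg=(\lambda+\rho S)g$, where $\mathcal{L}_X$ is the Lie derivative. (On $\mathbb{H}^2$, $\mathrm{Ric}=-ds^2$ and $S=-2$.) Integral signs without bounds denote smooth antiderivatives in the indicated variable (the other variable being a parameter), chosen once and for all; the same choice is used at every occurrence of the same expression. *)

theory Defs
  imports "HOL-Analysis.Analysis"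
begin

primrec Ck_on :: "'a::real_normed_vector set \<Rightarrow> nat \<Rightarrow> ('a \<Rightarrow> 'b::real_normed_vector) \<Rightarrow> bool" where
  "Ck_on U 0 f \<longleftrightarrow> continuous_on U f"
| "Ck_on U (Suc k) f \<longleftrightarrow>
     (\<forall>p\<in>U. f differentiable at p) \<and> (\<forall>v. Ck_on U k (\<lambda>p. frechet_derivative f (at p) v))"

text \<open>Meaningful for open \<open>U\<close> only: the derivatives are two-sided, and values of \<open>f\<close> outside \<open>U\<close>
  are irrelevant.\<close>

definition smooth_on :: "'a::real_normed_vector set \<Rightarrow> ('a \<Rightarrow> 'b::real_normed_vector) \<Rightarrow> bool" where
  "smooth_on U f \<longleftrightarrow> (\<forall>k. Ck_on U k f)"

definition partial :: "'n \<Rightarrow> (real ^ 'n \<Rightarrow> real) \<Rightarrow> real ^ 'n \<Rightarrow> real" where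
  "partial i f p = frechet_derivative f (at p) (axis i 1)"

definition smooth_antiderivative_on ::
    "(real ^ 'n) set \<Rightarrow> 'n \<Rightarrow> (real ^ 'n \<Rightarrow> real) \<Rightarrow> (real ^ 'n \<Rightarrow> real) \<Rightarrow> bool" where
  "smooth_antiderivative_on U i u F \<longleftrightarrow> smooth_on U F \<and> (\<forall>p\<in>U. partial i F p = u p)"

text \<open>A choice \<open>I\<close> of one antiderivative \<open>I f\<close> for every smooth \<open>f\<close> on the real line.\<close>

definition antiderivative_choice :: "((real \<Rightarrow> real) \<Rightarrow> real \<Rightarrow> real) \<Rightarrow> bool" where
  "antiderivative_choice I \<longleftrightarrow>
     (\<forall>f. smooth_on UNIV f \<longrightarrow>
        smooth_on UNIV (I f) \<and> (\<forall>x. (I f has_real_derivative f x) (at x)))"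

text \<open>The manifold is an open \<open>U \<subseteq> real ^ 'n\<close>. A \<open>(0,2)\<close>-tensor field is its matrix of components
  in the coordinate frame, so \<open>g p $ i $ j\<close> is \<open>g(\<partial>\<^sub>i, \<partial>\<^sub>j)\<close> at \<open>p\<close>, and the components
  of a vector field \<open>X\<close> are \<open>X p $ i\<close>.\<close>

definition riemannian_metric_on :: "(real ^ 'n) set \<Rightarrow> (real ^ 'n \<Rightarrow> real ^ 'n ^ 'n) \<Rightarrow> bool" where
  "riemannian_metric_on U g \<longleftrightarrow> smooth_on U g \<and>
     (\<forall>p\<in>U. transpose (g p) = g p \<and> (\<forall>v. v \<noteq> 0 \<longrightarrow> v \<bullet> (g p *v v) > 0))"

text \<open>\<open>christoffel g l i j\<close> has the upper index \<open>l\<close>.\<close>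

definition christoffel ::
    "(real ^ 'n \<Rightarrow> real ^ 'n ^ 'n) \<Rightarrow> 'n \<Rightarrow> 'n \<Rightarrow> 'n \<Rightarrow> real ^ 'n \<Rightarrow> real" where
  "christoffel g l i j p =
     (1/2) * (\<Sum>m\<in>UNIV. matrix_inv (g p) $ l $ m *
        (partial i (\<lambda>q. g q $ m $ j) p + partial j (\<lambda>q. g q $ m $ i) p
         - partial m (\<lambda>q. g q $ i $ j) p))"

text \<open>The component of \<open>R(\<partial>\<^sub>i, \<partial>\<^sub>j) \<partial>\<^sub>k\<close> along \<open>\<partial>\<^sub>l\<close>, where
  \<open>R(Y, Z) = \<nabla>\<^sub>Y \<nabla>\<^sub>Z - \<nabla>\<^sub>Z \<nabla>\<^sub>Y - \<nabla>\<^bsub>[Y, Z]\<^esub>\<close>.\<close>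

definition riemann ::
    "(real ^ 'n \<Rightarrow> real ^ 'n ^ 'n) \<Rightarrow> 'n \<Rightarrow> 'n \<Rightarrow> 'n \<Rightarrow> 'n \<Rightarrow> real ^ 'n \<Rightarrow> real" where
  "riemann g l i j k p =
     partial i (christoffel g l j k) p - partial j (christoffel g l i k) p
     + (\<Sum>m\<in>UNIV. christoffel g l i m p * christoffel g m j k p
                  - christoffel g l j m p * christoffel g m i k p)"

text \<open>\<open>Ric(Y, Z)\<close> is the trace of \<open>W \<mapsto> R(W, Y) Z\<close>; with this sign round spheres have positive
  Ricci curvature.\<close>

definition ricci :: "(real ^ 'n \<Rightarrow> real ^ 'n ^ 'n) \<Rightarrow> real ^ 'n \<Rightarrow> real ^ 'n ^ 'n" where
  "ricci g p = (\<chi> j k. \<Sum>i\<in>UNIV. riemann g i i j k p)"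

definition scalar_curvature :: "(real ^ 'n \<Rightarrow> real ^ 'n ^ 'n) \<Rightarrow> real ^ 'n \<Rightarrow> real" where
  "scalar_curvature g p = (\<Sum>j\<in>UNIV. \<Sum>k\<in>UNIV. matrix_inv (g p) $ j $ k * ricci g p $ j $ k)"

text \<open>\<open>(\<L>\<^sub>X g)(\<partial>\<^sub>i, \<partial>\<^sub>j) = X(g(\<partial>\<^sub>i, \<partial>\<^sub>j)) - g([X, \<partial>\<^sub>i], \<partial>\<^sub>j) - g(\<partial>\<^sub>i, [X, \<partial>\<^sub>j])\<close>,
  where \<open>[X, \<partial>\<^sub>i]\<close> has the components \<open>- \<partial>\<^sub>i X\<^sup>k\<close>.\<close>

definition lie_derivative_metric ::
    "(real ^ 'n \<Rightarrow> real ^ 'n) \<Rightarrow> (real ^ 'n \<Rightarrow> real ^ 'n ^ 'n) \<Rightarrow> real ^ 'n \<Rightarrow> real ^ 'n ^ 'n" where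
  "lie_derivative_metric X g p =
     (\<chi> i j. \<Sum>k\<in>UNIV. X p $ k * partial k (\<lambda>q. g q $ i $ j) p
        + g p $ k $ j * partial i (\<lambda>q. X q $ k) p
        + g p $ i $ k * partial j (\<lambda>q. X q $ k) p)"

definition G_Ricci_Bourguignon_soliton ::
    "(real ^ 'n) set \<Rightarrow> (real ^ 'n \<Rightarrow> real ^ 'n ^ 'n) \<Rightarrow> (real ^ 'n \<Rightarrow> real ^ 'n)
     \<Rightarrow> real \<Rightarrow> real \<Rightarrow> (real ^ 'n \<Rightarrow> real) \<Rightarrow> bool" where
  "G_Ricci_Bourguignon_soliton U g X lam rho G \<longleftrightarrow>
     open U \<and> riemannian_metric_on U g \<and> smooth_on U X \<and>
     smooth_on U G \<and> (\<forall>p\<in>U. G p \<noteq> 0) \<and>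
     (\<forall>p\<in>U. ricci g p + (G p / 2) *\<^sub>R lie_derivative_metric X g p
             = (lam + rho * scalar_curvature g p) *\<^sub>R g p)"

definition upper_half_plane :: "(real ^ 2) set" where
  "upper_half_plane = {p. p $ 2 > 0}"

definition hyperbolic_metric :: "real ^ 2 \<Rightarrow> real ^ 2 ^ 2" where
  "hyperbolic_metric p = (1 / (p $ 2)\<^sup>2) *\<^sub>R mat 1"

end

theory Submission
  imports Defs
begin

text \<open>
  Write \<open>X = M \<partial>\<^sub>x + N \<partial>\<^sub>y\<close> and \<open>c = \<lambda> - 2\<rho> + 1\<close>. On the half plane \<open>Ric = -g\<close> and \<open>S = -2\<close>, so the
  soliton equation says that \<open>\<L>\<^sub>X g = (2c / G) g\<close>. As \<open>g\<close> is \<open>1 / y\<^sup>2\<close> times the Euclidean metric, this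
  reads in components (\<open>soliton_equation_iff\<close>)
  \<open>M\<^sub>x = N / y + c / G\<close>, \<open>N\<^sub>y = N / y + c / G\<close>, \<open>M\<^sub>y + N\<^sub>x = 0\<close>.

  The middle equation is \<open>(N / y)\<^sub>y = c / (y G)\<close>, so \<open>N / y\<close> and \<open>c A\<close> differ by a function \<open>f\<close> of \<open>x\<close> alone.
  Inserting \<open>N = f y + c y A\<close> in the first equation gives \<open>M\<^sub>x = f + c A + c / G\<close>, so \<open>M\<close> and
  \<open>\<integral>f dx + c (B + C)\<close> differ by a function \<open>h\<close> of \<open>y\<close> alone. Both steps rest on \<open>eq_of_partial_eq_0\<close>,
  and \<open>f\<close> and \<open>h\<close> are smooth because they are combinations of smooth functions restricted to
  the lines \<open>y = 1\<close> and \<open>x = 0\<close>. Conversely, components of this form solve the first two equations.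
  For such components the third equation is exactly the compatibility condition that links \<open>h'\<close>
  and \<open>f'\<close>.

  Finally, the three equations imply \<open>M\<^sub>x = N\<^sub>y\<close> and \<open>M\<^sub>y = -N\<^sub>x\<close>. These are the Cauchy-Riemann
  equations, and the symmetry of second derivatives makes \<open>M\<close> and \<open>N\<close> harmonic.
\<close>

section \<open>Closure properties of smooth functions\<close>

lemma Ck_on_cong:
  assumes "open U" and "\<And>x. x \<in> U \<Longrightarrow> f x = g x" and "Ck_on U k f"
  shows "Ck_on U k g"
  using assms(2,3)
proof (induction k arbitrary: f g)
  case 0
  then show ?case by (simp cong: continuous_on_cong)
next
  case (Suc k)
  have diff: "f differentiable at p" if "p \<in> U" for p
    using Suc.prems that by simp
  have "g differentiable at p" if "p \<in> U" for p
    using has_derivative_transform_within_open[of f _ p UNIV U g] diff[OF that] assms(1) that Suc.prems(1)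
    unfolding differentiable_def by blast
  moreover have "Ck_on U k (\<lambda>p. frechet_derivative g (at p) v)" for v
  proof (rule Suc.IH)
    show "Ck_on U k (\<lambda>p. frechet_derivative f (at p) v)"
      using Suc.prems by simp
  qed (use frechet_derivative_transform_within_open[OF diff assms(1)] Suc.prems(1) in metis)
  ultimately show ?case by simp
qed

text \<open>The recursion for \<open>Ck_on\<close> speaks of \<open>frechet_derivative\<close>; this form accepts any formula for the
  derivative, so the derivative rules for sums, products and compositions apply directly.\<close>

lemma Ck_on_SucI:
  assumes "open U"
    and "\<And>p. p \<in> U \<Longrightarrow> (f has_derivative f' p) (at p)"
    and "\<And>v. Ck_on U k (\<lambda>p. f' p v)"
  shows "Ck_on U (Suc k) f"
proof -
  have "Ck_on U k (\<lambda>p. frechet_derivative f (at p) v)" for v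
    by (rule Ck_on_cong[OF assms(1) _ assms(3)[of v]]) (use assms(2) frechet_derivative_at in metis)
  then show ?thesis
    using assms(2) by (auto simp: differentiable_def)
qed

lemma Ck_on_SucD:
  assumes "Ck_on U (Suc k) f"
  shows "p \<in> U \<Longrightarrow> (f has_derivative frechet_derivative f (at p)) (at p)"
    and "Ck_on U k (\<lambda>p. frechet_derivative f (at p) v)"
  using assms by (auto simp flip: frechet_derivative_works)

lemma Ck_on_Suc_imp_Ck_on: "Ck_on U (Suc k) f \<Longrightarrow> Ck_on U k f"
proof (induction k arbitrary: f)
  case 0
  then show ?case
    by (auto intro!: continuous_at_imp_continuous_on differentiable_imp_continuous_within)
next
  case (Suc k)
  from Suc.prems have "\<forall>p\<in>U. f differentiable at p"
      "Ck_on U (Suc k) (\<lambda>p. frechet_derivative f (at p) v)" for v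
    by simp_all
  with Suc.IH show ?case by simp
qed

lemma Ck_on_const: "open U \<Longrightarrow> Ck_on U k (\<lambda>x. c)"
  by (induction k arbitrary: c) simp_all

lemma Ck_on_ident: "open U \<Longrightarrow> Ck_on U k (\<lambda>x. x)"
  by (cases k) (auto intro: Ck_on_SucI[OF _ has_derivative_ident] Ck_on_const simp del: Ck_on.simps(2))

lemma Ck_on_add:
  assumes "open U"
  shows "Ck_on U k f \<Longrightarrow> Ck_on U k g \<Longrightarrow> Ck_on U k (\<lambda>x. f x + g x)"
proof (induction k arbitrary: f g)
  case 0
  then show ?case by (simp add: continuous_on_add)
next
  case (Suc k)
  show ?case
    by (rule Ck_on_SucI[OF assms has_derivative_add[OF Ck_on_SucD(1) Ck_on_SucD(1)]])
      (use Suc in \<open>auto intro!: Suc.IH\<close>)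
qed

lemma Ck_on_bounded_linear_image:
  assumes "open U" and L: "bounded_linear L"
  shows "Ck_on U k f \<Longrightarrow> Ck_on U k (\<lambda>x. L (f x))"
proof (induction k arbitrary: f)
  case 0
  then show ?case by (simp add: bounded_linear.continuous_on[OF L])
next
  case (Suc k)
  show ?case
    by (rule Ck_on_SucI[OF assms(1) bounded_linear.has_derivative[OF L Ck_on_SucD(1)]])
      (use Suc in \<open>auto intro!: Suc.IH\<close>)
qed

lemma Ck_on_mult:
  fixes f g :: "'a::real_normed_vector \<Rightarrow> real"
  assumes "open U"
  shows "Ck_on U k f \<Longrightarrow> Ck_on U k g \<Longrightarrow> Ck_on U k (\<lambda>x. f x * g x)"
proof (induction k arbitrary: f g)
  case 0
  then show ?case by (simp add: continuous_on_mult)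
next
  case (Suc k)
  have "Ck_on U k (\<lambda>p. f p * frechet_derivative g (at p) v + frechet_derivative f (at p) v * g p)" for v
    by (intro Ck_on_add[OF assms] Suc.IH Ck_on_Suc_imp_Ck_on[OF Suc.prems(1)]
        Ck_on_Suc_imp_Ck_on[OF Suc.prems(2)] Ck_on_SucD(2) Suc.prems)
  with Ck_on_SucI[OF assms has_derivative_mult[OF Ck_on_SucD(1)[OF Suc.prems(1)] Ck_on_SucD(1)[OF Suc.prems(2)]]]
  show ?case by blast
qed

lemma Ck_on_inverse:
  fixes f :: "'a::real_normed_vector \<Rightarrow> real"
  assumes "open U" and nz: "\<And>x. x \<in> U \<Longrightarrow> f x \<noteq> 0"
  shows "Ck_on U k f \<Longrightarrow> Ck_on U k (\<lambda>x. inverse (f x))"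
proof (induction k)
  case 0
  then show ?case using nz by (simp add: continuous_on_inverse)
next
  case (Suc k)
  have inv: "Ck_on U k (\<lambda>x. inverse (f x))"
    by (rule Suc.IH[OF Ck_on_Suc_imp_Ck_on[OF Suc.prems]])
  have "Ck_on U k (\<lambda>p. - (inverse (f p) * frechet_derivative f (at p) v * inverse (f p)))" for v
    by (intro Ck_on_bounded_linear_image[OF assms(1) bounded_linear_minus[OF bounded_linear_ident]]
        Ck_on_mult[OF assms(1)] inv Ck_on_SucD(2)[OF Suc.prems])
  with Ck_on_SucI[OF assms(1) Deriv.has_derivative_inverse[OF nz Ck_on_SucD(1)[OF Suc.prems]]]
  show ?case by blast
qed

lemma Ck_on_compose_affine:
  assumes "open V" and L: "bounded_linear L" and sub: "\<And>x. x \<in> V \<Longrightarrow> a + L x \<in> U"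
  shows "Ck_on U k f \<Longrightarrow> Ck_on V k (\<lambda>x. f (a + L x))"
proof (induction k arbitrary: f)
  case 0
  have "continuous_on V (\<lambda>x. a + L x)"
    by (intro continuous_intros linear_continuous_on L)
  then show ?case
    using 0 sub by (auto intro!: continuous_on_compose2[of U f])
next
  case (Suc k)
  have aff: "((\<lambda>x. a + L x) has_derivative L) (at x)" for x
    using has_derivative_add[OF has_derivative_const bounded_linear_imp_has_derivative[OF L]]
    by simp
  have "((\<lambda>x. f (a + L x)) has_derivative (\<lambda>v. frechet_derivative f (at (a + L x)) (L v))) (at x)"
    if "x \<in> V" for x
    using diff_chain_at[OF aff Ck_on_SucD(1)[OF Suc.prems sub[OF that]]] by (simp add: o_def)
  from Ck_on_SucI[OF assms(1) this] show ?case
    using Suc.IH[OF Ck_on_SucD(2)[OF Suc.prems]] by blast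
qed

lemma smooth_on_const: "open U \<Longrightarrow> smooth_on U (\<lambda>x. c)"
  by (simp add: smooth_on_def Ck_on_const)

lemma smooth_on_add:
  "open U \<Longrightarrow> smooth_on U f \<Longrightarrow> smooth_on U g \<Longrightarrow> smooth_on U (\<lambda>x. f x + g x)"
  by (simp add: smooth_on_def Ck_on_add)

lemma smooth_on_bounded_linear_image:
  "open U \<Longrightarrow> bounded_linear L \<Longrightarrow> smooth_on U f \<Longrightarrow> smooth_on U (\<lambda>x. L (f x))"
  by (simp add: smooth_on_def Ck_on_bounded_linear_image)

lemma smooth_on_compose_affine:
  "open V \<Longrightarrow> bounded_linear L \<Longrightarrow> (\<And>x. x \<in> V \<Longrightarrow> a + L x \<in> U) \<Longrightarrow> smooth_on U f
    \<Longrightarrow> smooth_on V (\<lambda>x. f (a + L x))"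
  unfolding smooth_on_def by (blast intro: Ck_on_compose_affine)

lemma smooth_on_diff_cmult:
  fixes f g :: "'a::real_normed_vector \<Rightarrow> real"
  assumes "open U" "smooth_on U f" "smooth_on U g"
  shows "smooth_on U (\<lambda>x. f x - c * g x)"
  using smooth_on_add[OF assms(1,2)
      smooth_on_bounded_linear_image[OF assms(1) bounded_linear_mult_right[of "- c"] assms(3)]]
  by simp

lemma smooth_on_differentiable: "smooth_on U f \<Longrightarrow> p \<in> U \<Longrightarrow> f differentiable at p"
  unfolding smooth_on_def by (metis Ck_on.simps(2))

lemma smooth_on_frechet_derivative:
  "smooth_on U f \<Longrightarrow> smooth_on U (\<lambda>p. frechet_derivative f (at p) v)"
  unfolding smooth_on_def by (metis Ck_on.simps(2))

section \<open>Symmetry of second derivatives\<close>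

text \<open>The chain rule for \<open>t \<mapsto> a + t v\<close>. It reduces statements about directional
  derivatives to calculus in one variable.\<close>

lemma has_real_derivative_along_line:
  fixes f :: "'a::real_normed_vector \<Rightarrow> real"
  assumes "f differentiable at (a + t *\<^sub>R v)"
  shows "((\<lambda>t. f (a + t *\<^sub>R v)) has_real_derivative frechet_derivative f (at (a + t *\<^sub>R v)) v) (at t)"
proof -
  have "((\<lambda>t. a + t *\<^sub>R v) has_derivative (\<lambda>s. s *\<^sub>R v)) (at t)"
    by (auto intro!: derivative_eq_intros)
  from diff_chain_at[OF this] have "((\<lambda>t. f (a + t *\<^sub>R v)) has_derivative
      (\<lambda>s. frechet_derivative f (at (a + t *\<^sub>R v)) (s *\<^sub>R v))) (at t)"
    using assms by (auto simp: o_def frechet_derivative_works)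
  moreover have "frechet_derivative f (at (a + t *\<^sub>R v)) (s *\<^sub>R v)
      = frechet_derivative f (at (a + t *\<^sub>R v)) v * s" for s
    using linear_scale[OF linear_frechet_derivative[OF assms]] by simp
  ultimately show ?thesis
    by (simp add: has_field_derivative_def)
qed

lemma mean_value_along_line:
  fixes f :: "'a::real_normed_vector \<Rightarrow> real"
  assumes "\<And>t. 0 \<le> t \<Longrightarrow> t \<le> 1 \<Longrightarrow> f differentiable at (a + t *\<^sub>R v)"
  obtains t where "0 < t" "t < 1" "f (a + v) - f a = frechet_derivative f (at (a + t *\<^sub>R v)) v"
proof -
  from MVT2[of 0 1 "\<lambda>t. f (a + t *\<^sub>R v)" "\<lambda>t. frechet_derivative f (at (a + t *\<^sub>R v)) v"]
    has_real_derivative_along_line[OF assms]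
  show ?thesis using that by auto
qed

text \<open>The mean value theorem is applied twice: in direction \<open>u\<close> to \<open>q \<mapsto> f (q + v) - f q\<close>, then in
  direction \<open>v\<close> to the derivative of \<open>f\<close> along \<open>u\<close>. The second difference on the left is symmetric
  in \<open>u\<close> and \<open>v\<close>, the second derivative on the right is not visibly so.\<close>

lemma second_difference_mean_value:
  fixes f :: "'a::real_normed_vector \<Rightarrow> real"
  assumes "Ck_on U 2 f"
    and sub: "\<And>s t. 0 \<le> s \<Longrightarrow> s \<le> 1 \<Longrightarrow> 0 \<le> t \<Longrightarrow> t \<le> 1 \<Longrightarrow> p + s *\<^sub>R u + t *\<^sub>R v \<in> U"
  obtains s t where "0 < s" "s < 1" "0 < t" "t < 1"
    "f (p + u + v) - f (p + u) - f (p + v) + f p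
     = frechet_derivative (\<lambda>q. frechet_derivative f (at q) u) (at (p + s *\<^sub>R u + t *\<^sub>R v)) v"
proof -
  have diff: "f differentiable at q" "(\<lambda>q. frechet_derivative f (at q) u) differentiable at q"
    if "q \<in> U" for q
    using assms(1) that by (simp_all add: numeral_2_eq_2)
  have shift: "((\<lambda>q. f (q + v)) has_derivative frechet_derivative f (at (q + v))) (at q)"
    if "q + v \<in> U" for q
  proof -
    have "((\<lambda>q. q + v) has_derivative (\<lambda>h. h)) (at q)"
      by (auto intro!: derivative_eq_intros)
    from diff_chain_at[OF this] show ?thesis
      using diff(1)[OF that] by (simp add: o_def frechet_derivative_works)
  qed
  have d: "((\<lambda>q. f (q + v) - f q) has_derivative
      (\<lambda>h. frechet_derivative f (at (q + v)) h - frechet_derivative f (at q) h)) (at q)"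
    if "q + v \<in> U" "q \<in> U" for q
    by (intro has_derivative_diff shift that) (use diff(1)[OF that(2)] in \<open>simp add: frechet_derivative_works\<close>)
  have in_U: "p + s *\<^sub>R u + v \<in> U" "p + s *\<^sub>R u \<in> U" if "0 \<le> s" "s \<le> 1" for s
    using sub[of s 1] sub[of s 0] that by auto
  obtain s where s: "0 < s" "s < 1"
    "(f (p + u + v) - f (p + u)) - (f (p + v) - f p)
      = frechet_derivative (\<lambda>q. f (q + v) - f q) (at (p + s *\<^sub>R u)) u"
  proof (rule mean_value_along_line[of "\<lambda>q. f (q + v) - f q" p u])
    show "(\<lambda>q. f (q + v) - f q) differentiable at (p + t *\<^sub>R u)" if "0 \<le> t" "t \<le> 1" for t
      using d[OF in_U[OF that]] by (auto simp: differentiable_def)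
  qed blast
  have "frechet_derivative (\<lambda>q. f (q + v) - f q) (at (p + s *\<^sub>R u)) u
      = frechet_derivative f (at (p + s *\<^sub>R u + v)) u - frechet_derivative f (at (p + s *\<^sub>R u)) u"
    using fun_cong[OF frechet_derivative_at[OF d[OF in_U(1)[of s] in_U(2)[of s]]], of u] s by simp
  moreover obtain t where "0 < t" "t < 1"
    "frechet_derivative f (at (p + s *\<^sub>R u + v)) u - frechet_derivative f (at (p + s *\<^sub>R u)) u
      = frechet_derivative (\<lambda>q. frechet_derivative f (at q) u) (at (p + s *\<^sub>R u + t *\<^sub>R v)) v"
    by (rule mean_value_along_line[of "\<lambda>q. frechet_derivative f (at q) u" "p + s *\<^sub>R u" v])
      (use diff(2) sub s in auto)
  ultimately show ?thesis
    using s that by (simp add: algebra_simps)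
qed

text \<open>Small multiples \<open>h u\<close> and \<open>h v\<close> have one second difference at \<open>p\<close>, which equals \<open>h\<^sup>2\<close> times either
  mixed derivative at some point close to \<open>p\<close>. After division by \<open>h\<^sup>2\<close>, continuity of the mixed
  derivatives at \<open>p\<close> forces them to agree there.\<close>

lemma second_derivative_symmetric:
  fixes f :: "'a::real_normed_vector \<Rightarrow> real"
  assumes "open U" "p \<in> U" and C2: "Ck_on U 2 f"
  shows "frechet_derivative (\<lambda>q. frechet_derivative f (at q) u) (at p) v
       = frechet_derivative (\<lambda>q. frechet_derivative f (at q) v) (at p) u"
proof -
  define D where "D a b q = frechet_derivative (\<lambda>q. frechet_derivative f (at q) a) (at q) b" for a b q
  have diff1: "f differentiable at q" and diff2: "(\<lambda>q. frechet_derivative f (at q) a) differentiable at q"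
    if "q \<in> U" for q a
    using C2 that by (simp_all add: numeral_2_eq_2)
  have D_scale: "D (h *\<^sub>R a) (h *\<^sub>R b) q = h\<^sup>2 * D a b q" if "q \<in> U" for h a b q
  proof -
    have "frechet_derivative (\<lambda>q. frechet_derivative f (at q) (h *\<^sub>R a)) (at q)
        = (\<lambda>v. h * frechet_derivative (\<lambda>q. frechet_derivative f (at q) a) (at q) v)"
    proof (rule frechet_derivative_at[symmetric], rule has_derivative_transform_within_open[OF _ assms(1) that])
      show "((\<lambda>q. h * frechet_derivative f (at q) a) has_derivative
          (\<lambda>v. h * frechet_derivative (\<lambda>q. frechet_derivative f (at q) a) (at q) v)) (at q)"
        using diff2[OF that, of a] by (intro has_derivative_mult_right) (simp add: frechet_derivative_works)
    qed (use linear_scale[OF linear_frechet_derivative[OF diff1]] in simp)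
    then show ?thesis
      using linear_scale[OF linear_frechet_derivative[OF diff2[OF that]], of a]
      by (simp add: D_def power2_eq_square)
  qed
  have cont: "continuous (at p) (D a b)" for a b
    using C2 assms(1,2) by (simp add: numeral_2_eq_2 continuous_on_eq_continuous_at D_def[abs_def])
  have "\<bar>D u v p - D v u p\<bar> \<le> e" if "0 < e" for e
  proof -
    from cont[unfolded continuous_at_eps_delta] \<open>0 < e\<close>
    obtain d1 d2 where d: "0 < d1" "\<And>q. dist q p < d1 \<Longrightarrow> dist (D u v q) (D u v p) < e / 2"
      "0 < d2" "\<And>q. dist q p < d2 \<Longrightarrow> dist (D v u q) (D v u p) < e / 2"
      by (metis half_gt_zero)
    obtain r where r: "0 < r" "ball p r \<subseteq> U"
      using assms(1,2) open_contains_ball by blast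
    \<comment> \<open>The scale \<open>h\<close> keeps the parallelogram spanned by \<open>h u\<close> and \<open>h v\<close> at \<open>p\<close> within distance \<open>m\<close>
      of \<open>p\<close>; the summand 1 in \<open>w\<close> covers the case \<open>u = v = 0\<close>.\<close>
    define m where "m = min r (min d1 d2)"
    define w where "w = norm u + norm v + 1"
    define h where "h = m / (2 * w)"
    have w: "0 < w"
      by (simp add: w_def add_nonneg_pos)
    have w_bound: "norm u + norm v < 2 * w"
      using w by (smt (verit) w_def)
    from w have h: "0 < h"
      using d r by (simp add: m_def h_def)
    have near: "dist (p + s *\<^sub>R (h *\<^sub>R u) + t *\<^sub>R (h *\<^sub>R v)) p < m"
      if "0 \<le> s" "s \<le> 1" "0 \<le> t" "t \<le> 1" for s t
    proof -
      have "dist (p + s *\<^sub>R (h *\<^sub>R u) + t *\<^sub>R (h *\<^sub>R v)) p \<le> norm (s *\<^sub>R (h *\<^sub>R u)) + norm (t *\<^sub>R (h *\<^sub>R v))"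
        by (simp add: dist_norm norm_triangle_ineq add.assoc del: scaleR_scaleR norm_scaleR)
      also have "\<dots> \<le> 1 * (h * norm u) + 1 * (h * norm v)"
        using that h by (intro add_mono) (simp_all add: mult_left_le_one_le)
      also have "\<dots> = h * (norm u + norm v)" by (simp add: algebra_simps)
      also have "\<dots> < h * (2 * w)"
        using h w_bound by (intro mult_strict_left_mono)
      also have "\<dots> = m"
        using w by (simp add: h_def)
      finally show ?thesis .
    qed
    then have sub: "p + s *\<^sub>R (h *\<^sub>R u) + t *\<^sub>R (h *\<^sub>R v) \<in> U" if "0 \<le> s" "s \<le> 1" "0 \<le> t" "t \<le> 1" for s t
      using r that by (force simp: m_def dist_commute)
    then have sub': "p + s *\<^sub>R (h *\<^sub>R v) + t *\<^sub>R (h *\<^sub>R u) \<in> U" if "0 \<le> s" "s \<le> 1" "0 \<le> t" "t \<le> 1" for s t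
      using sub[OF that(3,4,1,2)] by (simp add: add_ac)
    obtain s t where st: "0 < s" "s < 1" "0 < t" "t < 1"
      "f (p + h *\<^sub>R u + h *\<^sub>R v) - f (p + h *\<^sub>R u) - f (p + h *\<^sub>R v) + f p
       = D (h *\<^sub>R u) (h *\<^sub>R v) (p + s *\<^sub>R (h *\<^sub>R u) + t *\<^sub>R (h *\<^sub>R v))"
      by (rule second_difference_mean_value[OF C2 sub, folded D_def])
    obtain s' t' where st': "0 < s'" "s' < 1" "0 < t'" "t' < 1"
      "f (p + h *\<^sub>R v + h *\<^sub>R u) - f (p + h *\<^sub>R v) - f (p + h *\<^sub>R u) + f p
       = D (h *\<^sub>R v) (h *\<^sub>R u) (p + s' *\<^sub>R (h *\<^sub>R v) + t' *\<^sub>R (h *\<^sub>R u))"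
      by (rule second_difference_mean_value[OF C2 sub', folded D_def])
    define q where "q = p + s *\<^sub>R (h *\<^sub>R u) + t *\<^sub>R (h *\<^sub>R v)"
    define q' where "q' = p + t' *\<^sub>R (h *\<^sub>R u) + s' *\<^sub>R (h *\<^sub>R v)"
    have q'_eq: "q' = p + s' *\<^sub>R (h *\<^sub>R v) + t' *\<^sub>R (h *\<^sub>R u)"
      by (simp add: q'_def)
    have "D (h *\<^sub>R u) (h *\<^sub>R v) q = D (h *\<^sub>R v) (h *\<^sub>R u) q'"
      using st(5) st'(5) by (simp add: q_def q'_eq algebra_simps del: scaleR_scaleR)
    moreover have "q \<in> U" "q' \<in> U"
      using sub st st' by (simp_all add: q_def q'_def)
    ultimately have "D u v q = D v u q'"
      using h by (simp add: D_scale)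
    moreover have "dist q p < m" "dist q' p < m"
      using near st st' by (simp_all add: q_def q'_def)
    then have "dist (D u v q) (D u v p) < e / 2" "dist (D v u q') (D v u p) < e / 2"
      using d by (simp_all add: m_def)
    ultimately show ?thesis
      unfolding dist_real_def by (smt (verit) field_sum_of_halves)
  qed
  then have "D u v p = D v u p"
    by (metis abs_le_zero_iff field_le_epsilon add_0 right_minus_eq)
  then show ?thesis by (simp add: D_def)
qed

section \<open>Partial derivatives\<close>

lemma partial_cong:
  assumes "open U" "p \<in> U" "f differentiable at p" "\<And>q. q \<in> U \<Longrightarrow> f q = g q"
  shows "partial i g p = partial i f p"
  using frechet_derivative_transform_within_open[OF assms(3,1,2,4)] by (simp add: partial_def)

lemma partial_eqI: "(f has_derivative f') (at p) \<Longrightarrow> partial i f p = f' (axis i 1)"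
  by (metis partial_def frechet_derivative_at)

lemma partial_add:
  assumes "f differentiable at p" "g differentiable at p"
  shows "partial i (\<lambda>q. f q + g q) p = partial i f p + partial i g p"
  using partial_eqI[OF has_derivative_add] assms by (simp add: frechet_derivative_works partial_def)

lemma partial_mult:
  assumes "f differentiable at p" "g differentiable at p"
  shows "partial i (\<lambda>q. f q * g q) p = f p * partial i g p + partial i f p * g p"
  using partial_eqI[OF has_derivative_mult] assms by (simp add: frechet_derivative_works partial_def)

lemma partial_cmult:
  assumes "f differentiable at p"
  shows "partial i (\<lambda>q. c * f q) p = c * partial i f p"
  using partial_eqI[OF has_derivative_mult_right] assms by (simp add: frechet_derivative_works partial_def)

lemma partial_diff:
  assumes "f differentiable at p" "g differentiable at p"
  shows "partial i (\<lambda>q. f q - g q) p = partial i f p - partial i g p"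
  using partial_eqI[OF has_derivative_diff] assms by (simp add: frechet_derivative_works partial_def)

lemma partial_const [simp]: "partial i (\<lambda>q. c) p = 0"
  by (simp add: partial_def)

lemma has_derivative_of_coordinate:
  assumes "(F has_real_derivative d) (at (p $ j))"
  shows "((\<lambda>q::real^'n. F (q $ j)) has_derivative (\<lambda>h. d * h $ j)) (at p)"
proof -
  have "((\<lambda>q::real^'n. q $ j) has_derivative (\<lambda>h. h $ j)) (at p)"
    by (intro bounded_linear_imp_has_derivative bounded_linear_vec_nth)
  from diff_chain_at[OF this assms[unfolded has_field_derivative_def]] show ?thesis
    by (simp add: o_def)
qed

lemma differentiable_of_coordinate:
  "(F has_real_derivative d) (at (p $ j)) \<Longrightarrow> (\<lambda>q::real^'n. F (q $ j)) differentiable at p"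
  using has_derivative_of_coordinate differentiable_def by blast

lemma partial_of_coordinate:
  "(F has_real_derivative d) (at (p $ j)) \<Longrightarrow> partial i (\<lambda>q. F (q $ j)) p = (if i = j then d else 0)"
  by (simp add: partial_eqI[OF has_derivative_of_coordinate] axis_def)

text \<open>By convexity the segment from \<open>p\<close> to \<open>q\<close>, which is parallel to the \<open>i\<close>-th axis, stays in \<open>U\<close>, so the
  mean value theorem applies on it. This is how an antiderivative in one variable is unique up to
  a function of the other.\<close>

lemma eq_of_partial_eq_0:
  fixes f :: "real^'n \<Rightarrow> real"
  assumes "convex U" "p \<in> U" "q \<in> U"
    and "\<And>r. r \<in> U \<Longrightarrow> f differentiable at r" "\<And>r. r \<in> U \<Longrightarrow> partial i f r = 0"
    and "\<And>j. j \<noteq> i \<Longrightarrow> p $ j = q $ j"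
  shows "f p = f q"
proof -
  define s where "s = q $ i - p $ i"
  have q: "q = p + s *\<^sub>R axis i 1"
    using assms(6) by (auto simp: vec_eq_iff s_def axis_def)
  have seg: "p + t *\<^sub>R (s *\<^sub>R axis i 1) \<in> U" if "0 \<le> t" "t \<le> 1" for t
  proof -
    have "p + t *\<^sub>R (s *\<^sub>R axis i 1) = (1 - t) *\<^sub>R p + t *\<^sub>R q"
      by (simp add: q algebra_simps)
    then show ?thesis
      using convexD_alt[OF assms(1-3) that] by simp
  qed
  obtain t where t: "0 < t" "t < 1"
    "f (p + s *\<^sub>R axis i 1) - f p
      = frechet_derivative f (at (p + t *\<^sub>R (s *\<^sub>R axis i 1))) (s *\<^sub>R axis i 1)"
    using mean_value_along_line[of f p "s *\<^sub>R axis i 1"] assms(4) seg by blast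
  have r: "p + t *\<^sub>R (s *\<^sub>R axis i 1) \<in> U"
    using seg t by simp
  show ?thesis
    using t(3) linear_scale[OF linear_frechet_derivative[OF assms(4)[OF r]], of s "axis i 1"] assms(5)[OF r]
    by (simp add: q partial_def)
qed

lemma partial_commute:
  fixes f :: "real^'n \<Rightarrow> real"
  assumes "open U" "smooth_on U f" "p \<in> U"
  shows "partial i (partial j f) p = partial j (partial i f) p"
  using second_derivative_symmetric[OF assms(1,3), of f "axis j 1" "axis i 1"] assms(2)
  unfolding partial_def[abs_def] smooth_on_def by blast

lemma smooth_on_partial: "smooth_on U f \<Longrightarrow> smooth_on U (partial i f)"
  unfolding partial_def[abs_def] by (rule smooth_on_frechet_derivative)

lemma smooth_on_component: "open U \<Longrightarrow> smooth_on U X \<Longrightarrow> smooth_on U (\<lambda>p. X p $ i)"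
  by (rule smooth_on_bounded_linear_image[OF _ bounded_linear_vec_nth])

text \<open>Substituting the two equations turns the Laplacian of either function into the difference of the
  mixed derivatives of the other one, up to sign.\<close>

lemma cauchy_riemann_imp_harmonic:
  fixes M N :: "real^2 \<Rightarrow> real"
  assumes "open U" "smooth_on U M" "smooth_on U N"
    and CR: "\<And>p. p \<in> U \<Longrightarrow> partial 1 M p = partial 2 N p"
            "\<And>p. p \<in> U \<Longrightarrow> partial 2 M p = - partial 1 N p"
    and "p \<in> U"
  shows "partial 1 (partial 1 M) p + partial 2 (partial 2 M) p = 0"
    and "partial 1 (partial 1 N) p + partial 2 (partial 2 N) p = 0"
proof -
  have diff: "partial i M differentiable at p" "partial i N differentiable at p" for i
    using assms(2,3) \<open>p \<in> U\<close> by (blast intro: smooth_on_differentiable smooth_on_partial)+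
  have neg: "partial i (\<lambda>q. - partial j F q) p = - partial i (partial j F) p"
    if "partial j F differentiable at p" for i j F
    using partial_cmult[OF that, of i "-1"] by simp
  have "partial 1 (partial 1 M) p = partial 1 (partial 2 N) p"
    by (rule partial_cong[OF assms(1) \<open>p \<in> U\<close> diff(2)]) (simp add: CR)
  moreover have "partial 2 (partial 2 M) p = - partial 2 (partial 1 N) p"
    using partial_cong[OF assms(1) \<open>p \<in> U\<close>, of "\<lambda>q. - partial 1 N q" "partial 2 M" 2] diff(2) CR
    by (simp add: neg differentiable_minus)
  ultimately show "partial 1 (partial 1 M) p + partial 2 (partial 2 M) p = 0"
    using partial_commute[OF assms(1,3) \<open>p \<in> U\<close>, of 1 2] by simp
  have "partial 2 (partial 2 N) p = partial 2 (partial 1 M) p"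
    by (rule partial_cong[OF assms(1) \<open>p \<in> U\<close> diff(1)]) (simp add: CR)
  moreover have "partial 1 (partial 1 N) p = - partial 1 (partial 2 M) p"
    using partial_cong[OF assms(1) \<open>p \<in> U\<close>, of "\<lambda>q. - partial 2 M q" "partial 1 N" 1] diff(1) CR
    by (simp add: neg differentiable_minus)
  ultimately show "partial 1 (partial 1 N) p + partial 2 (partial 2 N) p = 0"
    using partial_commute[OF assms(1,2) \<open>p \<in> U\<close>, of 1 2] by simp
qed

section \<open>Curvature of the half plane\<close>

lemma open_upper_half_plane: "open upper_half_plane"
  unfolding upper_half_plane_def by (intro open_halfspace_component_gt_cart)

lemma convex_upper_half_plane: "convex upper_half_plane"
proof -
  have "upper_half_plane = {p. axis 2 1 \<bullet> p > 0}"
    by (simp add: upper_half_plane_def inner_axis')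
  then show ?thesis
    using convex_halfspace_gt[of 0 "axis 2 1 :: real^2"] by simp
qed

lemma hyperbolic_metric_component:
  "hyperbolic_metric p $ i $ j = (if i = j then inverse ((p $ 2)\<^sup>2) else 0)"
  by (simp add: hyperbolic_metric_def mat_def divide_inverse)

lemma smooth_on_hyperbolic_metric: "smooth_on upper_half_plane hyperbolic_metric"
proof -
  have "Ck_on upper_half_plane k (\<lambda>p. p $ 2)" for k
    using Ck_on_bounded_linear_image[OF open_upper_half_plane bounded_linear_vec_nth
        Ck_on_ident[OF open_upper_half_plane]] .
  then have "Ck_on upper_half_plane k (\<lambda>p. inverse (p $ 2 * p $ 2) *\<^sub>R mat 1 :: real^2^2)" for k
    using Ck_on_bounded_linear_image[OF open_upper_half_plane bounded_linear_scaleR_left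
        Ck_on_inverse[OF open_upper_half_plane _ Ck_on_mult[OF open_upper_half_plane]],
        of "\<lambda>p. p $ 2" "\<lambda>p. p $ 2" k "mat 1 :: real^2^2"]
    by (simp add: upper_half_plane_def)
  then show ?thesis
    by (simp add: smooth_on_def hyperbolic_metric_def[abs_def] power2_eq_square divide_inverse)
qed

lemma riemannian_metric_on_hyperbolic: "riemannian_metric_on upper_half_plane hyperbolic_metric"
  unfolding riemannian_metric_on_def
proof (intro conjI ballI allI impI smooth_on_hyperbolic_metric)
  fix p v :: "real^2" assume p: "p \<in> upper_half_plane"
  show "transpose (hyperbolic_metric p) = hyperbolic_metric p"
    by (simp add: hyperbolic_metric_def transpose_scalar transpose_mat)
  assume "v \<noteq> 0"
  then show "v \<bullet> (hyperbolic_metric p *v v) > 0"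
    using p by (simp add: hyperbolic_metric_def upper_half_plane_def flip: scaleR_matrix_vector_assoc)
qed

lemma partial_hyperbolic_metric:
  assumes "p \<in> upper_half_plane"
  shows "partial k (\<lambda>q. hyperbolic_metric q $ i $ j) p = (if i = j \<and> k = 2 then - 2 / (p $ 2)^3 else 0)"
proof -
  have "((\<lambda>y. inverse (y\<^sup>2)) has_real_derivative - 2 / (p $ 2)^3) (at (p $ 2))"
    using assms by (auto simp: upper_half_plane_def power2_eq_square power3_eq_cube divide_simps intro!: derivative_eq_intros)
  from partial_of_coordinate[OF this] show ?thesis
    by (cases "i = j") (simp_all add: hyperbolic_metric_component)
qed

lemma matrix_inv_hyperbolic_metric:
  assumes "p \<in> upper_half_plane"
  shows "matrix_inv (hyperbolic_metric p) = (p $ 2)\<^sup>2 *\<^sub>R mat 1"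
proof -
  have *: "hyperbolic_metric p ** ((p $ 2)\<^sup>2 *\<^sub>R mat 1) = mat 1"
    using assms by (simp add: hyperbolic_metric_def upper_half_plane_def matrix_scalar_ac flip: scalar_matrix_assoc)
  then have "((p $ 2)\<^sup>2 *\<^sub>R mat 1) ** hyperbolic_metric p = mat 1"
    by (simp add: matrix_left_right_inverse)
  with * have "\<exists>B. hyperbolic_metric p ** B = mat 1 \<and> B ** hyperbolic_metric p = mat 1"
    by blast
  from someI_ex[OF this] have inv: "matrix_inv (hyperbolic_metric p) ** hyperbolic_metric p = mat 1"
    by (simp add: matrix_inv_def)
  have "matrix_inv (hyperbolic_metric p)
      = matrix_inv (hyperbolic_metric p) ** (hyperbolic_metric p ** ((p $ 2)\<^sup>2 *\<^sub>R mat 1))"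
    by (simp only: * matrix_mul_rid)
  also have "\<dots> = (p $ 2)\<^sup>2 *\<^sub>R mat 1"
    by (simp only: inv matrix_mul_assoc matrix_mul_lid)
  finally show ?thesis .
qed

text \<open>Each Christoffel symbol of the half plane is a constant multiple of \<open>1 / y\<close>; these are the
  constants, with the upper index first.\<close>

definition hyperbolic_christoffel_coeff :: "2 \<Rightarrow> 2 \<Rightarrow> 2 \<Rightarrow> real" where
  "hyperbolic_christoffel_coeff l i j = (if i = j \<and> l = 2 then 1 else 0) - (if l = j \<and> i = 2 then 1 else 0) - (if l = i \<and> j = 2 then 1 else 0)"

lemma christoffel_hyperbolic:
  assumes "p \<in> upper_half_plane"
  shows "christoffel hyperbolic_metric l i j p = hyperbolic_christoffel_coeff l i j * inverse (p $ 2)"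
proof -
  have "p $ 2 \<noteq> 0" using assms by (simp add: upper_half_plane_def)
  then have "\<forall>l i j. christoffel hyperbolic_metric l i j p = hyperbolic_christoffel_coeff l i j * inverse (p $ 2)"
    by (simp add: forall_2 christoffel_def partial_hyperbolic_metric[OF assms]
       matrix_inv_hyperbolic_metric[OF assms] sum_2 hyperbolic_christoffel_coeff_def mat_def power2_eq_square power3_eq_cube divide_simps)
  then show ?thesis by blast
qed

text \<open>The formula for the symbols is only available inside the open half plane, which suffices because
  a derivative at \<open>p\<close> depends on a neighbourhood of \<open>p\<close>.\<close>

lemma partial_christoffel_hyperbolic:
  assumes "p \<in> upper_half_plane"
  shows "partial m (christoffel hyperbolic_metric l i j) p = (if m = 2 then - hyperbolic_christoffel_coeff l i j / (p $ 2)\<^sup>2 else 0)"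
proof -
  have deriv: "((\<lambda>y. hyperbolic_christoffel_coeff l i j * inverse y) has_real_derivative - hyperbolic_christoffel_coeff l i j / (p $ 2)\<^sup>2) (at (p $ 2))"
    using assms by (auto simp: upper_half_plane_def power2_eq_square divide_simps intro!: derivative_eq_intros)
  show ?thesis
    using partial_cong[OF open_upper_half_plane assms differentiable_of_coordinate[OF deriv],
        of "christoffel hyperbolic_metric l i j" m]
    by (simp add: christoffel_hyperbolic partial_of_coordinate[OF deriv])
qed

lemma ricci_hyperbolic:
  assumes "p \<in> upper_half_plane"
  shows "ricci hyperbolic_metric p = - hyperbolic_metric p"
  using assms by (simp add: vec_eq_iff forall_2 ricci_def riemann_def sum_2
     partial_christoffel_hyperbolic christoffel_hyperbolic hyperbolic_metric_component hyperbolic_christoffel_coeff_def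
     upper_half_plane_def power2_eq_square divide_simps)

lemma scalar_curvature_hyperbolic:
  assumes "p \<in> upper_half_plane"
  shows "scalar_curvature hyperbolic_metric p = - 2"
  using assms by (simp add: scalar_curvature_def ricci_hyperbolic sum_2 matrix_inv_hyperbolic_metric
     hyperbolic_metric_component mat_def upper_half_plane_def)

section \<open>The soliton equation in components\<close>

lemma lie_derivative_hyperbolic_metric:
  assumes "p \<in> upper_half_plane"
  shows "lie_derivative_metric X hyperbolic_metric p $ i $ j =
    inverse ((p $ 2)\<^sup>2) * (partial i (\<lambda>q. X q $ j) p + partial j (\<lambda>q. X q $ i) p)
      - (if i = j then 2 * X p $ 2 / (p $ 2)^3 else 0)"
proof -
  have "\<forall>i j. lie_derivative_metric X hyperbolic_metric p $ i $ j =
    inverse ((p $ 2)\<^sup>2) * (partial i (\<lambda>q. X q $ j) p + partial j (\<lambda>q. X q $ i) p)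
      - (if i = j then 2 * X p $ 2 / (p $ 2)^3 else 0)"
    unfolding forall_2 lie_derivative_metric_def sum_2
    by (simp add: partial_hyperbolic_metric[OF assms])
      (simp add: hyperbolic_metric_component algebra_simps)
  then show ?thesis by blast
qed

text \<open>With \<open>Ric = -g\<close> and \<open>S = -2\<close> the diagonal entries give the equations for \<open>M\<^sub>x\<close> and \<open>N\<^sub>y\<close>, and the
  off-diagonal ones, where \<open>g\<close> vanishes, give \<open>M\<^sub>y + N\<^sub>x = 0\<close>.\<close>

lemma soliton_equation_iff:
  assumes p: "p \<in> upper_half_plane" and "G p \<noteq> 0"
  shows "ricci hyperbolic_metric p + (G p / 2) *\<^sub>R lie_derivative_metric X hyperbolic_metric p
             = (lam + rho * scalar_curvature hyperbolic_metric p) *\<^sub>R hyperbolic_metric p \<longleftrightarrow>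
    partial 1 (\<lambda>q. X q $ 1) p = X p $ 2 / p $ 2 + (lam - 2 * rho + 1) / G p \<and>
    partial 2 (\<lambda>q. X q $ 2) p = X p $ 2 / p $ 2 + (lam - 2 * rho + 1) / G p \<and>
    partial 2 (\<lambda>q. X q $ 1) p + partial 1 (\<lambda>q. X q $ 2) p = 0"
proof -
  define y g where "y = p $ 2" and "g = G p"
  have y: "y > 0" "g \<noteq> 0" using assms by (simp_all add: y_def g_def upper_half_plane_def)
  have *: "g * (inverse (y\<^sup>2) * (2 * d) - 2 * N / y^3) / 2 - inverse (y\<^sup>2) = (lam - rho * 2) * inverse (y\<^sup>2)
     \<longleftrightarrow> d = N / y + (lam - 2 * rho + 1) / g" for N d
  proof -
    have "g * (inverse (y\<^sup>2) * (2 * d) - 2 * N / y^3) / 2 - inverse (y\<^sup>2) - (lam - rho * 2) * inverse (y\<^sup>2)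
        = g / y\<^sup>2 * (d - (N / y + (lam - 2 * rho + 1) / g))"
      using y by (simp add: field_simps power2_eq_square power3_eq_cube)
    then show ?thesis
      using y by (metis divide_eq_0_iff mult_eq_0_iff power_eq_0_iff less_irrefl right_minus_eq)
  qed
  show ?thesis
    unfolding vec_eq_iff forall_2
    using y
    by (simp add: lie_derivative_hyperbolic_metric[OF p] ricci_hyperbolic[OF p]
      scalar_curvature_hyperbolic[OF p] hyperbolic_metric_component flip: y_def g_def)
    (auto simp: *)
qed

section \<open>Solving the component equations\<close>

theorem theorem3p1:
  fixes X :: "real ^ 2 \<Rightarrow> real ^ 2"
    and lam rho :: real
    and G A B C :: "real ^ 2 \<Rightarrow> real"
    and I :: "(real \<Rightarrow> real) \<Rightarrow> real \<Rightarrow> real"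
  assumes "smooth_on upper_half_plane X"
    and "smooth_on upper_half_plane G"
    and "\<And>p. p \<in> upper_half_plane \<Longrightarrow> G p \<noteq> 0"
    and "smooth_antiderivative_on upper_half_plane 2 (\<lambda>p. 1 / (p $ 2 * G p)) A"
    and "smooth_antiderivative_on upper_half_plane 1 A B"
    and "smooth_antiderivative_on upper_half_plane 1 (\<lambda>p. 1 / G p) C"
    and "antiderivative_choice I"
  shows "(G_Ricci_Bourguignon_soliton upper_half_plane hyperbolic_metric X lam rho G \<longleftrightarrow>
      (\<exists>f h. smooth_on (UNIV :: real set) f \<and> smooth_on {0<..} h \<and>
        (\<forall>p\<in>upper_half_plane. X p = vector
           [I f (p $ 1) + (lam - 2 * rho + 1) * (B p + C p) + h (p $ 2),
            f (p $ 1) * p $ 2 + (lam - 2 * rho + 1) * p $ 2 * A p]) \<and>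
        (\<forall>p\<in>upper_half_plane.
           deriv h (p $ 2) + deriv f (p $ 1) * p $ 2 =
             (- lam + 2 * rho - 1) *
               (partial 1 (\<lambda>q. q $ 2 * A q) p + partial 2 B p + partial 2 C p))))
    \<and> (G_Ricci_Bourguignon_soliton upper_half_plane hyperbolic_metric X lam rho G \<longrightarrow>
        (\<forall>p\<in>upper_half_plane. \<forall>i.
           partial 1 (partial 1 (\<lambda>q. X q $ i)) p + partial 2 (partial 2 (\<lambda>q. X q $ i)) p = 0))"
    (is "(?soliton \<longleftrightarrow> ?representation) \<and> (?soliton \<longrightarrow> ?harmonic)")
proof -
  define H :: "(real^2) set" where "H = upper_half_plane"
  have H: "open H" "convex H" and H_iff: "\<And>p. p \<in> H \<longleftrightarrow> 0 < p $ 2"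
    using open_upper_half_plane convex_upper_half_plane by (simp_all add: H_def upper_half_plane_def)
  define c where "c = lam - 2 * rho + 1"
  define M N where "M = (\<lambda>q. X q $ 1)" and "N = (\<lambda>q. X q $ 2)"
  have smooth: "smooth_on H M" "smooth_on H N" "smooth_on H A" "smooth_on H B" "smooth_on H C"
    using assms(1,4-6) smooth_on_component[OF open_upper_half_plane]
    by (simp_all add: M_def N_def H_def smooth_antiderivative_on_def)
  note diff = smooth[THEN smooth_on_differentiable]
  have partial_A: "partial 2 A p = 1 / (p $ 2 * G p)"
    and partial_B: "partial 1 B p = A p"
    and partial_C: "partial 1 C p = 1 / G p" if "p \<in> H" for p
    using assms(4-6) that by (simp_all add: H_def smooth_antiderivative_on_def)
  have y_diff: "(\<lambda>q::real^2. q $ 2) differentiable at p" for p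
    by (rule differentiable_of_coordinate[where F = "\<lambda>y. y"]) (rule DERIV_ident)
  have partial_y: "partial i (\<lambda>q::real^2. q $ 2) p = (if i = 2 then 1 else 0)" for i p
    by (rule partial_of_coordinate[where F = "\<lambda>y. y"]) (rule DERIV_ident)
  have soliton_iff: "?soliton \<longleftrightarrow> (\<forall>p\<in>H. partial 1 M p = N p / p $ 2 + c / G p \<and>
      partial 2 N p = N p / p $ 2 + c / G p \<and> partial 2 M p + partial 1 N p = 0)"
    unfolding G_Ricci_Bourguignon_soliton_def H_def M_def N_def c_def
    using assms(1-3) open_upper_half_plane riemannian_metric_on_hyperbolic soliton_equation_iff
    by simp

  have smooth_imp_deriv: "(F has_real_derivative deriv F t) (at t)" if "smooth_on T F" "t \<in> T" for F :: "real \<Rightarrow> real" and T t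
    using smooth_on_differentiable[OF that]
    by (simp add: DERIV_deriv_iff_real_differentiable)
  have partial_M_part: "partial i (\<lambda>q. F (q $ 1) + c * (B q + C q)) p
      = (if i = 1 then F' else 0) + c * (partial i B p + partial i C p)"
    if "p \<in> H" "(F has_real_derivative F') (at (p $ 1))" for F F' p and i :: 2
    using diff(4,5)[OF that(1)] differentiable_of_coordinate[OF that(2)]
    by (simp add: partial_add partial_cmult partial_of_coordinate[OF that(2)])
  have partial_N_part: "partial i (\<lambda>q. f (q $ 1) * q $ 2 + c * (q $ 2 * A q)) p
      = f (p $ 1) * (if i = 2 then 1 else 0) + (if i = 1 then f' else 0) * p $ 2
        + c * partial i (\<lambda>q. q $ 2 * A q) p"
    if "p \<in> H" "(f has_real_derivative f') (at (p $ 1))" for f f' p and i :: 2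
    using diff(3)[OF that(1)] differentiable_of_coordinate[OF that(2)] y_diff
    by (simp add: partial_add partial_cmult partial_mult partial_y partial_of_coordinate[OF that(2)])
  have partial_yA: "partial 2 (\<lambda>q. q $ 2 * A q) p = A p + 1 / G p" if "p \<in> H" for p
    using diff(3)[OF that] y_diff that by (simp add: partial_mult partial_y partial_A H_iff)
  have I: "smooth_on UNIV (I f)" "(I f has_real_derivative f x) (at x)" if "smooth_on UNIV f" for f x
    using assms(7) that by (simp_all add: antiderivative_choice_def)

  \<comment> \<open>Components of the stated form satisfy the two diagonal equations, and turn the off-diagonal one
    into the compatibility condition. Both directions of the equivalence use this.\<close>
  have represented: "((\<forall>p\<in>H. partial 1 M p = N p / p $ 2 + c / G p \<and>
      partial 2 N p = N p / p $ 2 + c / G p) \<and>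
      (\<forall>p\<in>H. partial 2 M p + partial 1 N p = 0 \<longleftrightarrow>
        deriv h (p $ 2) + deriv f (p $ 1) * p $ 2 =
             - c * (partial 1 (\<lambda>q. q $ 2 * A q) p + partial 2 B p + partial 2 C p)))"
    if f: "smooth_on UNIV f" and h: "smooth_on {0<..} h"
      and M: "\<And>p. p \<in> H \<Longrightarrow> M p = I f (p $ 1) + c * (B p + C p) + h (p $ 2)"
      and N: "\<And>p. p \<in> H \<Longrightarrow> N p = f (p $ 1) * p $ 2 + c * (p $ 2 * A p)" for f h
  proof -
    have dM: "partial i M p = (if i = 1 then f (p $ 1) else 0) + c * (partial i B p + partial i C p)
        + (if i = 2 then deriv h (p $ 2) else 0)" if "p \<in> H" for i p
    proof -
      have dh: "(h has_real_derivative deriv h (p $ 2)) (at (p $ 2))"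
        using smooth_imp_deriv[OF h] that by (simp add: H_iff)
      have "partial i M p = partial i (\<lambda>q. I f (q $ 1) + c * (B q + C q) + h (q $ 2)) p"
        using partial_cong[OF H(1) that diff(1)[OF that] M] by simp
      also have "\<dots> = partial i (\<lambda>q. I f (q $ 1) + c * (B q + C q)) p + partial i (\<lambda>q. h (q $ 2)) p"
        using diff(4,5)[OF that] differentiable_of_coordinate[where p = p and j = 1, OF I(2)[OF f]]
          differentiable_of_coordinate[OF dh]
        by (intro partial_add) simp_all
      finally show ?thesis
        by (simp add: partial_M_part[OF that I(2)[OF f]] partial_of_coordinate[OF dh])
    qed
    have dN: "partial i N p = f (p $ 1) * (if i = 2 then 1 else 0) + (if i = 1 then deriv f (p $ 1) else 0) * p $ 2
        + c * partial i (\<lambda>q. q $ 2 * A q) p" if "p \<in> H" for i p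
      using partial_N_part[OF that smooth_imp_deriv[OF f]]
        partial_cong[OF H(1) that diff(2)[OF that] N] by simp
    have "N p / p $ 2 = f (p $ 1) + c * A p" if "p \<in> H" for p
      using that by (simp add: N H_iff field_simps)
    then show ?thesis
      by (auto simp: dM dN partial_B partial_C partial_yA distrib_left)
  qed

  have "?representation" if ?soliton
  proof -
    from that soliton_iff have M1: "partial 1 M p = N p / p $ 2 + c / G p"
      and N2: "partial 2 N p = N p / p $ 2 + c / G p"
      and M2: "partial 2 M p + partial 1 N p = 0" if "p \<in> H" for p
      using that by blast+
    \<comment> \<open>The lines \<open>y = 1\<close> and \<open>x = 0\<close> are arbitrary: they select representatives of two expressions
      that will turn out to depend on one variable only.\<close>
    define f where "f x = N (vector [x, 1]) - c * A (vector [x, 1])" for x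
    define h where "h y = M (vector [0, y]) - c * (B (vector [0, y]) + C (vector [0, y])) - I f 0" for y
    have on_horizontal: "vector [x, 1] = axis 2 1 + x *\<^sub>R (axis 1 1 :: real^2)" for x
      by (simp add: vec_eq_iff forall_2 axis_def)
    have on_vertical: "vector [0, y] = 0 + y *\<^sub>R (axis 2 1 :: real^2)" for y
      by (simp add: vec_eq_iff forall_2 axis_def)
    have smooth_hor: "smooth_on UNIV (\<lambda>x. F (vector [x, 1]))" if "smooth_on H F" for F :: "real^2 \<Rightarrow> real"
      unfolding on_horizontal
      by (rule smooth_on_compose_affine[OF _ _ _ that]) (auto simp: H_iff axis_def bounded_linear_scaleR_left)
    have smooth_vert: "smooth_on {0<..} (\<lambda>y. F (vector [0, y]))" if "smooth_on H F" for F :: "real^2 \<Rightarrow> real"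
      unfolding on_vertical
      by (rule smooth_on_compose_affine[OF _ _ _ that]) (auto simp: H_iff axis_def bounded_linear_scaleR_left)
    have f: "smooth_on UNIV f"
      unfolding f_def by (intro smooth_on_diff_cmult smooth_hor smooth open_UNIV)
    have h: "smooth_on {0<..} h"
    proof -
      have "smooth_on {0<..} (\<lambda>y. M (vector [0, y]) - c * (B (vector [0, y]) + C (vector [0, y])))"
        by (intro smooth_on_diff_cmult smooth_on_add smooth_vert smooth open_greaterThan)
      from smooth_on_add[OF open_greaterThan this smooth_on_const[OF open_greaterThan]] show ?thesis
        unfolding h_def[abs_def] diff_conv_add_uminus[of _ "I f 0"] .
    qed
    have N: "N p = f (p $ 1) * p $ 2 + c * (p $ 2 * A p)" if p: "p \<in> H" for p
    proof -
      have d: "(\<lambda>q. inverse (q $ 2)) differentiable at q" "partial 2 (\<lambda>q. inverse (q $ 2)) q = - inverse ((q $ 2)\<^sup>2)"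
        if "q \<in> H" for q :: "real^2"
      proof -
        have "(inverse has_real_derivative - inverse ((q $ 2)\<^sup>2)) (at (q $ 2))"
          using that by (auto simp: H_iff power2_eq_square intro!: derivative_eq_intros)
        then show "(\<lambda>q. inverse (q $ 2)) differentiable at q" "partial 2 (\<lambda>q. inverse (q $ 2)) q = - inverse ((q $ 2)\<^sup>2)"
          by (simp_all add: differentiable_of_coordinate partial_of_coordinate)
      qed
      \<comment> \<open>The difference \<open>N / y - c A\<close> is constant on vertical lines.\<close>
      have "N p * inverse (p $ 2) - c * A p = N (vector [p $ 1, 1]) * inverse ((vector [p $ 1, 1] :: real^2) $ 2) - c * A (vector [p $ 1, 1])"
      proof (rule eq_of_partial_eq_0[OF H(2) p, of "vector [p $ 1, 1]" "\<lambda>q. N q * inverse (q $ 2) - c * A q" 2])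
        show "(\<lambda>q. N q * inverse (q $ 2) - c * A q) differentiable at r" if "r \<in> H" for r
          using diff[OF that] d[OF that] by simp
        show "partial 2 (\<lambda>q. N q * inverse (q $ 2) - c * A q) r = 0" if "r \<in> H" for r
        proof -
          have "partial 2 (\<lambda>q. N q * inverse (q $ 2) - c * A q) r
              = (N r / r $ 2 + c / G r) * inverse (r $ 2) - N r * inverse ((r $ 2)\<^sup>2) - c / (r $ 2 * G r)"
            using diff[OF that] d[OF that] by (simp add: partial_diff partial_mult partial_cmult N2 partial_A that)
          also have "\<dots> = 0"
            by (simp add: divide_inverse algebra_simps power2_eq_square)
          finally show ?thesis .
        qed
        show "p $ j = vector [p $ 1, 1] $ j" if "j \<noteq> 2" for j
          using exhaust_2[of j] that by auto
      qed (simp add: H_iff)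
      then show ?thesis
        using p by (simp add: f_def H_iff field_simps)
    qed
    have M: "M p = I f (p $ 1) + c * (B p + C p) + h (p $ 2)" if p: "p \<in> H" for p
    proof -
      \<comment> \<open>The difference of \<open>M\<close> and its candidate antiderivative is constant on horizontal lines.\<close>
      have "M p - (I f (p $ 1) + c * (B p + C p))
         = M (vector [0, p $ 2]) - (I f ((vector [0, p $ 2] :: real^2) $ 1) + c * (B (vector [0, p $ 2]) + C (vector [0, p $ 2])))"
      proof (rule eq_of_partial_eq_0[OF H(2) p, of "vector [0, p $ 2]" "\<lambda>q. M q - (I f (q $ 1) + c * (B q + C q))" 1])
        fix r assume r: "r \<in> H"
        have d: "(\<lambda>q. I f (q $ 1) + c * (B q + C q)) differentiable at r"
          using diff[OF r] differentiable_of_coordinate[where p = r and j = 1, OF I(2)[OF f]] by simp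
        then show "(\<lambda>q. M q - (I f (q $ 1) + c * (B q + C q))) differentiable at r"
          using diff(1)[OF r] by simp
        show "partial 1 (\<lambda>q. M q - (I f (q $ 1) + c * (B q + C q))) r = 0"
          unfolding partial_diff[OF diff(1)[OF r] d] partial_M_part[OF r I(2)[OF f]]
          using r by (simp add: M1 N partial_B partial_C H_iff field_simps)
      next
        show "p $ j = vector [0, p $ 2] $ j" if "j \<noteq> 1" for j
          using exhaust_2[of j] that by auto
      qed (use p in \<open>simp add: H_iff\<close>)
      then show ?thesis
        by (simp add: h_def)
    qed
    show ?representation
    proof (rule exI[of _ f], rule exI[of _ h], intro conjI f h ballI)
      fix p assume "p \<in> upper_half_plane"
      then have p: "p \<in> H" by (simp add: H_def)
      show "X p = vector [I f (p $ 1) + (lam - 2 * rho + 1) * (B p + C p) + h (p $ 2),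
            f (p $ 1) * p $ 2 + (lam - 2 * rho + 1) * p $ 2 * A p]"
        using M[OF p] N[OF p] by (simp add: vec_eq_iff forall_2 M_def N_def c_def)
      show "deriv h (p $ 2) + deriv f (p $ 1) * p $ 2 =
             (- lam + 2 * rho - 1) *
               (partial 1 (\<lambda>q. q $ 2 * A q) p + partial 2 B p + partial 2 C p)"
        using represented[OF f h M N] M2[OF p] p by (simp add: c_def)
    qed
  qed
  moreover have ?soliton if ?representation
  proof -
    from that obtain f h where f: "smooth_on UNIV f" and h: "smooth_on {0<..} h"
      and X: "\<forall>p\<in>H. X p = vector [I f (p $ 1) + c * (B p + C p) + h (p $ 2), f (p $ 1) * p $ 2 + c * p $ 2 * A p]"
      and eq: "\<forall>p\<in>H. deriv h (p $ 2) + deriv f (p $ 1) * p $ 2 =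
             (- lam + 2 * rho - 1) * (partial 1 (\<lambda>q. q $ 2 * A q) p + partial 2 B p + partial 2 C p)"
      unfolding H_def c_def by blast
    have "- lam + 2 * rho - 1 = - c" by (simp add: c_def)
    with represented[OF f h] X eq show ?thesis
      unfolding soliton_iff by (simp add: M_def N_def)
  qed
  moreover have ?harmonic if ?soliton
  proof -
    have "partial 1 M p = partial 2 N p" "partial 2 M p = - partial 1 N p" if "p \<in> H" for p
      using \<open>?soliton\<close> that unfolding soliton_iff by (auto simp: add_eq_0_iff2)
    from cauchy_riemann_imp_harmonic[OF H(1) smooth(1,2) this] show ?thesis
      by (simp add: forall_2 M_def N_def H_def)
  qed
  ultimately show ?thesis by blast
qed

end
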